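(* Let $\psi\in\mathcal M$ be a primitive morphism whose normalized name $w=N(\psi)$ satisfies $w\in\{a,b,\alpha,\beta\}^*\setminus\{a,\alpha\}^*$, and let $\mathbf u$ be the (unique) fixed point of $\psi$. Then an infinite word $\mathbf x$ is, up to a permutation of letters, a derivated word $d_{\mathbf u}(v)$ of $\mathbf u$ with respect to one of its prefixes $v$ if and only if $\mathbf x$ is the fixed point of the morphism $\Delta^j(\psi)$ for some $j\ge 1$.
   Context: Let $\varphi_a:0\mapsto 0,1\mapsto 10$; $\varphi_b:0\mapsto0,1\mapsto 01$; $\varphi_\alpha:0\mapsto 01,1\mapsto 1$; $\varphi_\beta:0\mapsto 10,1\mapsto 1$. For a nonempty word $u=u_0\cdots u_{n-1}$ over $\{a,b,\alpha,\beta\}$ put $\varphi_u=\varphi_{u_0}\circ\cdots\circ\varphi_{u_{n-1}}$; $\mathcal M$ is the monoid generated by $\varphi_a,\varphi_b,\varphi_\alpha,\varphi_\beta$. It is known that $\varphi_w=\varphi_v$ iff $v$ is obtained from $w$ by the rewriting rules $\alpha a^k\beta=\beta b^k\alpha$, $a\alpha^kb=b\beta^ka$ ($k\in\mathbb N$), which preserve positions of Latin letters $a,b$ and Greek letters $\alpha,\beta$. With $a<b$, $\alpha<\beta$, the normalized name $N(w)$ is the lexicographically greatest word obtainable from $w$ by these rules, and $N(\psi)=N(w)$ for $\psi=\varphi_w$. Every normalized name not in $\{a,\alpha\}^*$ begins with $a^k\beta$ or $\alpha^kb$ for some $k\in\mathbb N$. For such a normalized name $w$ define $\Delta(w)=N(w'a^k\beta)$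 if $w=a^k\beta w'$ and $\Delta(w)=N(w'\alpha^kb)$ if $w=\alpha^kbw'$, and $\Delta(\psi)=\varphi_{\Delta(w)}$ when $N(\psi)=w$. A morphism is primitive if some power $\psi^k$ maps every letter to a word containing every letter. Derivated words: for a prefix $v$ of a uniformly recurrent word $\mathbf u=u_0u_1\cdots$, a return word to $v$ is $u_i\cdots u_{j-1}$ for consecutive occurrences $i<j$ of $v$; if the return words are $r_0,\dots,r_{k-1}$ and $\mathbf u=r_{s_0}r_{s_1}\cdots$, then $d_{\mathbf u}(v)=s_0s_1\cdots$.
   Formalization: Prefixes v are taken nonempty, and "up to a permutation of letters" applies to both sides of the equivalence; the claim fails for the empty prefix (e.g. N(ψ)=bα), and fails if the permutation is allowed on the left side only (e.g. N(ψ)=ββb). *)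

theory Defs
  imports Main "HOL-Library.Stream" "HOL-Combinatorics.Permutations"
begin

datatype gen = LA | LB | Alpha | Beta

text \<open>Words over the binary alphabet are lists over \<open>{0,1} \<subseteq> nat\<close>. The elementary morphisms act as
  the identity on the irrelevant letters \<open>n \<ge> 2\<close>, so equality of two elements of the monoid as HOL
  functions is equality of morphisms over \<open>{0,1}\<close>.\<close>

fun gen_letter :: "gen \<Rightarrow> nat \<Rightarrow> nat list" where
  "gen_letter LA n = (if n = 1 then [1,0] else [n])"
| "gen_letter LB n = (if n = 1 then [0,1] else [n])"
| "gen_letter Alpha n = (if n = 0 then [0,1] else [n])"
| "gen_letter Beta n = (if n = 0 then [1,0] else [n])"

definition gen_morph :: "gen \<Rightarrow> nat list \<Rightarrow> nat list" where
  "gen_morph c xs = concat (map (gen_letter c) xs)"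

definition phi :: "gen list \<Rightarrow> nat list \<Rightarrow> nat list" where
  "phi w = foldr (\<lambda>c f. gen_morph c \<circ> f) w id"

inductive_set special_morphisms :: "(nat list \<Rightarrow> nat list) set" where
  special_id: "id \<in> special_morphisms"
| special_step: "\<psi> \<in> special_morphisms \<Longrightarrow> gen_morph c \<circ> \<psi> \<in> special_morphisms"

definition primitive :: "(nat list \<Rightarrow> nat list) \<Rightarrow> bool" where
  "primitive \<psi> \<longleftrightarrow> (\<exists>k. \<forall>i\<in>{0,1}. {0,1} \<subseteq> set ((\<psi> ^^ k) [i]))"

text \<open>The infinite word \<open>\<psi>(x)\<close> is the concatenation of the images of the letters of \<open>x\<close>.\<close>

definition fixed_point :: "(nat list \<Rightarrow> nat list) \<Rightarrow> nat stream \<Rightarrow> bool" where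
  "fixed_point \<psi> x \<longleftrightarrow> sset x \<subseteq> {0,1} \<and> flat (smap (\<lambda>i. \<psi> [i]) x) = x"

inductive name_rewrite :: "gen list \<Rightarrow> gen list \<Rightarrow> bool" where
  greek: "name_rewrite (x @ [Alpha] @ replicate k LA @ [Beta] @ y)
                  (x @ [Beta] @ replicate k LB @ [Alpha] @ y)"
| latin: "name_rewrite (x @ [LA] @ replicate k Alpha @ [LB] @ y)
                  (x @ [LB] @ replicate k Beta @ [LA] @ y)"

text \<open>The order \<open>a < b\<close>, \<open>\<alpha> < \<beta>\<close> is partial, but total on each rewriting class, because rewriting
  preserves length and the positions of Latin and of Greek letters.\<close>

definition name_less :: "gen list \<Rightarrow> gen list \<Rightarrow> bool" where
  "name_less v w \<longleftrightarrow> (v, w) \<in> lexord {(LA, LB), (Alpha, Beta)}"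

definition normalize :: "gen list \<Rightarrow> gen list" where
  "normalize w = (THE v. equivclp name_rewrite w v \<and>
     (\<forall>v'. equivclp name_rewrite w v' \<longrightarrow> v' = v \<or> name_less v' v))"

text \<open>The choice of the name \<open>w\<close> of \<open>\<psi>\<close> is immaterial, since two names of the same morphism are related
  by rewriting.\<close>

definition normal_name :: "(nat list \<Rightarrow> nat list) \<Rightarrow> gen list" where
  "normal_name \<psi> = normalize (SOME w. phi w = \<psi>)"

definition Delta_name :: "gen list \<Rightarrow> gen list" where
  "Delta_name w = (THE z. \<exists>k w'.
     w = replicate k LA @ [Beta] @ w' \<and> z = normalize (w' @ replicate k LA @ [Beta]) \<or>
     w = replicate k Alpha @ [LB] @ w' \<and> z = normalize (w' @ replicate k Alpha @ [LB]))"

definition Delta :: "(nat list \<Rightarrow> nat list) \<Rightarrow> (nat list \<Rightarrow> nat list)" where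
  "Delta \<psi> = phi (Delta_name (normal_name \<psi>))"

definition is_prefix :: "'a list \<Rightarrow> 'a stream \<Rightarrow> bool" where
  "is_prefix v u \<longleftrightarrow> stake (length v) u = v"

definition occurs_at :: "'a list \<Rightarrow> 'a stream \<Rightarrow> nat \<Rightarrow> bool" where
  "occurs_at v u i \<longleftrightarrow> is_prefix v (sdrop i u)"

definition return_words :: "'a stream \<Rightarrow> 'a list \<Rightarrow> 'a list set" where
  "return_words u v = {stake (j - i) (sdrop i u) | i j.
     i < j \<and> occurs_at v u i \<and> occurs_at v u j \<and> (\<forall>l. i < l \<and> l < j \<longrightarrow> \<not> occurs_at v u l)}"

text \<open>The derivated word depends on the enumeration \<open>r\<^sub>0, \<dots>, r\<^sub>k\<^sub>-\<^sub>1\<close> of the return words, hence a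
  relation.\<close>

definition derivated_word :: "'a stream \<Rightarrow> 'a list \<Rightarrow> nat stream \<Rightarrow> bool" where
  "derivated_word u v d \<longleftrightarrow> (\<exists>r. distinct r \<and> set r = return_words u v \<and>
     sset d \<subseteq> {..<length r} \<and> u = flat (smap (\<lambda>i. r ! i) d))"

definition eq_up_to_perm :: "nat stream \<Rightarrow> nat stream \<Rightarrow> bool" where
  "eq_up_to_perm x y \<longleftrightarrow> (\<exists>\<pi>. \<pi> permutes {0,1} \<and> x = smap \<pi> y)"

end

theory Submission
  imports Defs
begin

text \<open>Let \<open>\<psi> = \<phi>\<^sub>p \<circ> \<phi>\<^sub>w\<^sub>'\<close> with \<open>p = a\<^sup>k \<beta>\<close> or \<open>p = \<alpha>\<^sup>k b\<close> be read off the normalized name. If \<open>u\<close> is the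
  fixed point of \<open>\<psi>\<close>, then \<open>y = \<phi>\<^sub>w\<^sub>'(u)\<close> is the fixed point of \<open>\<Delta>(\<psi>)\<close>, and \<open>u = \<phi>\<^sub>p(y)\<close>. Unique
  desubstitution of \<open>\<phi>\<^sub>p\<close> matches the occurrences of each nonempty prefix of \<open>u\<close> with those of a
  strictly shorter, possibly empty prefix of \<open>y\<close>, and every prefix of \<open>y\<close> arises in this way;
  \<open>\<phi>\<^sub>p\<close> carries the return words of the latter to those of the former, so the derivated words
  agree. With respect to the empty prefix, a word is its own derivated word up to a permutation of
  letters. Iterating gives both directions. The argument applies to
  whichever name of the morphism is chosen, so of the presentation theorem only the soundness of the
  rewriting rules enters.\<close>

section \<open>Substitutions on infinite words\<close>

definition subst :: "('a \<Rightarrow> 'b list) \<Rightarrow> 'a stream \<Rightarrow> 'b stream" where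
  "subst f x = flat (smap f x)"

lemma subst_Stream: "f a \<noteq> [] \<Longrightarrow> subst f (a ## x) = f a @- subst f x"
  by (simp add: subst_def)

lemma subst_unfold: "f (shd x) \<noteq> [] \<Longrightarrow> subst f x = f (shd x) @- subst f (stl x)"
  by (metis stream.collapse subst_Stream)

lemma subst_shift:
  "(\<And>a. a \<in> set xs \<Longrightarrow> f a \<noteq> []) \<Longrightarrow> subst f (xs @- x) = concat (map f xs) @- subst f x"
  by (induction xs) (auto simp: subst_Stream)

lemma sset_subst: "(\<And>a. a \<in> sset x \<Longrightarrow> f a \<noteq> []) \<Longrightarrow> sset (subst f x) = (\<Union>a\<in>sset x. set (f a))"
  unfolding subst_def by (subst sset_flat) (auto simp: stream.set_map)

lemma stream_eqI_stake: "(\<And>n. stake n x = stake n y) \<Longrightarrow> x = y"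
proof -
  assume eq: "\<And>n. stake n x = stake n y"
  have "x !! n = y !! n" for n
    using eq[of "Suc n"] by (metis stake_nth lessI)
  then show ?thesis using smap_alt[of id x y] by (simp add: stream.map_id)
qed

lemma subst_eqI:
  assumes step: "\<And>d. P d \<Longrightarrow> h (shd d) \<noteq> [] \<and> H d = h (shd d) @- H (stl d) \<and> P (stl d)"
    and "P d"
  shows "H d = subst h d"
proof (rule stream_eqI_stake)
  fix n show "stake n (H d) = stake n (subst h d)" using \<open>P d\<close>
  proof (induction n arbitrary: d rule: less_induct)
    case (less n)
    note s = step[OF less.prems]
    have "stake (n - length (h (shd d))) (H (stl d)) = stake (n - length (h (shd d))) (subst h (stl d))"
    proof (cases "n = 0")
      case False
      then show ?thesis using s by (intro less.IH) auto
    qed simp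
    then show ?case using s
      by (metis (no_types, lifting) stake_shift subst_unfold)
  qed
qed

lemma subst_subst:
  assumes f: "\<And>n. f n \<noteq> []" and g: "\<And>a. a \<in> sset d \<Longrightarrow> g a \<noteq> []"
  shows "subst f (subst g d) = subst (\<lambda>a. concat (map f (g a))) d"
proof (rule subst_eqI[where P = "\<lambda>d. \<forall>a\<in>sset d. g a \<noteq> []"])
  show "\<forall>a\<in>sset d. g a \<noteq> []" using g by blast
next
  fix d assume d: "\<forall>a\<in>sset d. g a \<noteq> []"
  then have "g (shd d) \<noteq> []" by (simp add: shd_sset)
  then show "concat (map f (g (shd d))) \<noteq> [] \<and>
      subst f (subst g d) = concat (map f (g (shd d))) @- subst f (subst g (stl d)) \<and>
      (\<forall>a\<in>sset (stl d). g a \<noteq> [])"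
    using f d by (subst subst_unfold[of g]) (auto simp: subst_shift stl_sset neq_Nil_conv)
qed

lemma subst_cong: "(\<And>a. a \<in> sset x \<Longrightarrow> f a = g a) \<Longrightarrow> subst f x = subst g x"
  by (simp add: subst_def cong: stream.map_cong)

lemma subst_singleton: "subst (\<lambda>a. [f a]) x = smap f x"
  by (rule subst_eqI[where P = "\<lambda>_. True", symmetric]) (simp_all add: stream.expand)

lemma is_prefix_Nil [simp]: "is_prefix [] x"
  by (simp add: is_prefix_def)

lemma is_prefix_Cons [simp]: "is_prefix (a # v) (b ## x) \<longleftrightarrow> a = b \<and> is_prefix v x"
  by (auto simp: is_prefix_def)

lemma is_prefix_Cons': "is_prefix (a # v) x \<longleftrightarrow> a = shd x \<and> is_prefix v (stl x)"
  by (auto simp: is_prefix_def)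

lemma is_prefix_stake [simp]: "is_prefix (stake n x) x"
  by (simp add: is_prefix_def)

lemma stream_eqI_prefix: "(\<And>v. is_prefix v x \<Longrightarrow> is_prefix v y) \<Longrightarrow> x = y"
  by (metis is_prefix_def is_prefix_stake length_stake stream_eqI_stake)

section \<open>Desubstitution of prefixes\<close>

text \<open>\<open>before 0 1\<close> and \<open>before 1 0\<close> are \<open>\<phi>\<^sub>b\<close> and \<open>\<phi>\<^sub>\<beta>\<close>; \<open>after 0 1\<close> and \<open>after 1 0\<close> are
  \<open>\<phi>\<^sub>\<alpha>\<close> and \<open>\<phi>\<^sub>a\<close>.\<close>

definition before :: "'a \<Rightarrow> 'a \<Rightarrow> 'a \<Rightarrow> 'a list" where
  "before s t n = (if n = t then [s, t] else [n])"

definition after :: "'a \<Rightarrow> 'a \<Rightarrow> 'a \<Rightarrow> 'a list" where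
  "after s t n = (if n = s then [s, t] else [n])"

lemma before_simps [simp]: "before s t t = [s, t]" "n \<noteq> t \<Longrightarrow> before s t n = [n]"
  by (simp_all add: before_def)

lemma after_simps [simp]: "after s t s = [s, t]" "n \<noteq> s \<Longrightarrow> after s t n = [n]"
  by (simp_all add: after_def)

lemma before_nonempty [simp]: "before s t n \<noteq> []"
  by (simp add: before_def)

lemma after_nonempty [simp]: "after s t n \<noteq> []"
  by (simp add: after_def)

lemma inj_concat_before:
  assumes "s \<noteq> t" shows "inj (\<lambda>xs. concat (map (before s t) xs))"
proof (rule injI)
  fix xs ys assume "concat (map (before s t) xs) = concat (map (before s t) ys)"
  then show "xs = ys"
  proof (induction xs arbitrary: ys)
    case Nil then show ?case by (cases ys) auto
  next
    case (Cons x xs)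
    have no: "concat (map (before s t) zs) \<noteq> t # ws" for zs ws
      using assms by (cases zs; cases "hd zs = t") auto
    from Cons.prems obtain y ys' where ys: "ys = y # ys'" by (cases ys) auto
    have "x = y" using Cons.prems no no[symmetric] assms unfolding ys
      by (cases "x = t"; cases "y = t") auto
    then show ?case using Cons.prems Cons.IH[of ys'] unfolding ys by simp
  qed
qed

lemma inj_concat_after:
  assumes "s \<noteq> t" shows "inj (\<lambda>xs. concat (map (after s t) xs))"
proof (rule injI)
  fix xs ys assume "concat (map (after s t) xs) = concat (map (after s t) ys)"
  then show "xs = ys"
  proof (induction xs arbitrary: ys)
    case Nil then show ?case by (cases ys) auto
  next
    case (Cons x xs)
    from Cons.prems obtain y ys' where ys: "ys = y # ys'" by (cases ys) auto
    show ?case using Cons.prems Cons.IH[of ys'] unfolding ys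
      by (cases "x = s"; cases "y = s") auto
  qed
qed

lemma desubst_prefix_before:
  assumes "s \<noteq> t" "sset y \<subseteq> {s, t}" "is_prefix v (subst (before s t) y)" "v \<noteq> []"
  shows "\<exists>v'. is_prefix v' y \<and> length v' < length v \<and>
    (\<forall>z. sset z \<subseteq> {s, t} \<longrightarrow> is_prefix v (subst (before s t) z) \<longleftrightarrow> is_prefix v' z)"
  using assms(2-)
proof (induction "length v" arbitrary: v y rule: less_induct)
  case less
  let ?B = "before s t"
  obtain a y' where y: "y = a ## y'" by (cases y)
  have y': "sset y' \<subseteq> {s, t}" and a: "a = s \<or> a = t" using less.prems(1) y by auto
  have hd: "shd (subst ?B z) = s" if "sset z \<subseteq> {s, t}" for z
    using that by (cases z; cases "shd z = t") (auto simp: subst_Stream)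
  obtain v1 where v: "v = s # v1"
    using less.prems(2,3) hd[OF less.prems(1)] by (cases v) (auto simp: is_prefix_Cons')
  consider "v1 = []" | v2 where "v1 = s # v2" | b v2 where "v1 = b # v2" "b \<noteq> s"
    by (cases v1) auto
  then show ?case
  proof cases
    case 1
    then show ?thesis using v hd by (intro exI[of _ "[]"]) (auto simp: is_prefix_Cons')
  next
    case 2
    then have "a = s" using less.prems(2) v a assms(1)
      by (auto simp: y subst_Stream)
    then have p: "is_prefix v1 (subst ?B y')"
      using less.prems(2) assms(1) by (simp add: v y subst_Stream)
    obtain v' where v': "is_prefix v' y'" "length v' < length v1"
      "\<forall>z. sset z \<subseteq> {s, t} \<longrightarrow> is_prefix v1 (subst ?B z) \<longleftrightarrow> is_prefix v' z"
      using less.hyps[OF _ y' p] v 2 by auto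
    show ?thesis
    proof (intro exI[of _ "s # v'"] conjI allI impI)
      fix z assume z: "sset z \<subseteq> {s, t}"
      then show "is_prefix v (subst ?B z) \<longleftrightarrow> is_prefix (s # v') z"
        using v v'(3) 2 assms(1)
        by (cases z; cases "shd z = t") (auto simp: subst_Stream)
    qed (use v v' y \<open>a = s\<close> in auto)
  next
    case 3
    have "a = t"
    proof (rule ccontr)
      assume "a \<noteq> t"
      then show False using less.prems(2) v a 3 hd[OF y']
        by (auto simp: y subst_Stream is_prefix_Cons')
    qed
    then have bt: "b = t" and p: "is_prefix v2 (subst ?B y')"
      using less.prems(2) assms(1) 3 by (auto simp add: v y subst_Stream)
    obtain v' where v': "is_prefix v' y'" "length v' \<le> length v2"
      "\<forall>z. sset z \<subseteq> {s, t} \<longrightarrow> is_prefix v2 (subst ?B z) \<longleftrightarrow> is_prefix v' z"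
    proof (cases "v2 = []")
      case True
      then show ?thesis using that[of "[]"] by auto
    next
      case False
      then show ?thesis using less.hyps[OF _ y' p] v 3 that by fastforce
    qed
    show ?thesis
    proof (intro exI[of _ "t # v'"] conjI allI impI)
      fix z assume z: "sset z \<subseteq> {s, t}"
      then have "sset (stl z) \<subseteq> {s, t}" by (auto dest: stl_sset)
      from hd[OF this] z show "is_prefix v (subst ?B z) \<longleftrightarrow> is_prefix (t # v') z"
        using v v'(3) 3 bt assms(1)
        by (cases z) (auto simp: subst_Stream is_prefix_Cons')
    qed (use v v' y 3 \<open>a = t\<close> in auto)
  qed
qed

lemma prefix_before_iff:
  assumes "s \<noteq> t" "sset z \<subseteq> {s, t}"
  shows "is_prefix (concat (map (before s t) v) @ [s]) (subst (before s t) z) \<longleftrightarrow> is_prefix v z"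
  using assms(2)
proof (induction v arbitrary: z)
  case Nil
  then show ?case
    by (cases z; cases "shd z = t") (auto simp: subst_Stream)
next
  case (Cons a v)
  obtain b z' where z: "z = b ## z'" by (cases z)
  have z': "sset z' \<subseteq> {s, t}" and b: "b = s \<or> b = t" using Cons.prems z by auto
  have hd: "shd (subst (before s t) z') = s"
    using z' by (cases z'; cases "shd z' = t") (auto simp: subst_Stream)
  have nt: "\<not> is_prefix (t # ws) (subst (before s t) z')" for ws
    using hd assms(1) by (auto simp: is_prefix_Cons')
  obtain c ws where st: "concat (map (before s t) v) @ [s] = c # ws" "c \<noteq> t"
    using assms(1) by (cases v; cases "hd v = t") auto
  show ?case
    using Cons.IH[OF z'] b assms(1) nt st
    by (cases "a = t") (auto simp: z subst_Stream)
qed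

lemma desubst_prefix_after:
  assumes "s \<noteq> t" "sset y \<subseteq> {s, t}" "is_prefix v (subst (after s t) y)"
  shows "\<exists>v'. is_prefix v' y \<and> length v' \<le> length v \<and> (v' = [] \<longrightarrow> v = []) \<and>
    (\<forall>z. sset z \<subseteq> {s, t} \<longrightarrow> is_prefix v (subst (after s t) z) \<longleftrightarrow> is_prefix v' z)"
  using assms(2-)
proof (induction "length v" arbitrary: v y rule: less_induct)
  case less
  let ?A = "after s t"
  obtain a y' where y: "y = a ## y'" by (cases y)
  have y': "sset y' \<subseteq> {s, t}" and a: "a = s \<or> a = t" using less.prems(1) y by auto
  consider "v = []" | "v = [s]" | v1 where "v = t # v1" | v1 where "v = s # t # v1"
    using less.prems(2) a assms(1)
    by (cases v; cases "tl v") (auto simp: y subst_Stream)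
  then show ?case
  proof cases
    case 1
    then show ?thesis by (intro exI[of _ "[]"]) auto
  next
    case 2
    have "is_prefix [s] (subst ?A z) \<longleftrightarrow> is_prefix [s] z" for z
      by (cases z; cases "shd z = s") (auto simp: subst_Stream)
    then show ?thesis using 2 less.prems(2) by (intro exI[of _ "[s]"]) auto
  next
    case 3
    then have "a = t" and p: "is_prefix v1 (subst ?A y')" using less.prems(2) a assms(1)
      by (auto simp: y subst_Stream)
    obtain v' where v': "is_prefix v' y'" "length v' \<le> length v1"
      "\<forall>z. sset z \<subseteq> {s, t} \<longrightarrow> is_prefix v1 (subst ?A z) \<longleftrightarrow> is_prefix v' z"
      using less.hyps[OF _ y' p] 3 by auto
    show ?thesis
    proof (intro exI[of _ "t # v'"] conjI allI impI)
      fix z assume z: "sset z \<subseteq> {s, t}"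
      then show "is_prefix v (subst ?A z) \<longleftrightarrow> is_prefix (t # v') z"
        using v'(3) 3 assms(1) by (cases z; cases "shd z = t") (auto simp: subst_Stream)
    qed (use 3 v' y \<open>a = t\<close> in auto)
  next
    case 4
    then have "a = s" and p: "is_prefix v1 (subst ?A y')" using less.prems(2) a assms(1)
      by (auto simp: y subst_Stream)
    obtain v' where v': "is_prefix v' y'" "length v' \<le> length v1"
      "\<forall>z. sset z \<subseteq> {s, t} \<longrightarrow> is_prefix v1 (subst ?A z) \<longleftrightarrow> is_prefix v' z"
      using less.hyps[OF _ y' p] 4 by auto
    show ?thesis
    proof (intro exI[of _ "s # v'"] conjI allI impI)
      fix z assume z: "sset z \<subseteq> {s, t}"
      then show "is_prefix v (subst ?A z) \<longleftrightarrow> is_prefix (s # v') z"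
        using v'(3) 4 assms(1) by (cases z; cases "shd z = t") (auto simp: subst_Stream)
    qed (use 4 v' y \<open>a = s\<close> in auto)
  qed
qed

lemma prefix_after_iff:
  assumes "s \<noteq> t" "sset z \<subseteq> {s, t}"
  shows "is_prefix (concat (map (after s t) v)) (subst (after s t) z) \<longleftrightarrow> is_prefix v z"
  using assms(2)
proof (induction v arbitrary: z)
  case (Cons a v)
  obtain b z' where z: "z = b ## z'" by (cases z)
  show ?case
    using Cons assms(1) by (cases "a = s") (auto simp: z subst_Stream)
qed simp

section \<open>Return words and derivated words under substitution\<close>

lemma sdrop_subst:
  assumes "\<And>n. f n \<noteq> []"
  shows "sdrop (length (concat (map f (stake m y)))) (subst f y) = subst f (sdrop m y)"
proof -
  have "subst f y = concat (map f (stake m y)) @- subst f (sdrop m y)"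
    by (metis assms stake_sdrop subst_shift)
  then show ?thesis by (simp add: sdrop_shift)
qed

lemma subst_position:
  assumes "\<And>n. f n \<noteq> []"
  obtains m q where "i = length (concat (map f (stake m y))) + q" "q < length (f (y !! m))"
proof -
  have "\<exists>m q. i = length (concat (map f (stake m y))) + q \<and> q < length (f (y !! m))"
  proof (induction i)
    case 0
    then show ?case using assms by (intro exI[of _ 0]) auto
  next
    case (Suc i)
    then obtain m q where mq: "i = length (concat (map f (stake m y))) + q" "q < length (f (y !! m))"
      by blast
    show ?case
    proof (cases "Suc q < length (f (y !! m))")
      case True
      then show ?thesis using mq by (intro exI[of _ m] exI[of _ "Suc q"]) auto
    next
      case False
      then have "Suc q = length (f (y !! m))" using mq by simp
      then show ?thesis using mq assms
        by (intro exI[of _ "Suc m"] exI[of _ 0]) (auto simp: stake_Suc simp del: stake.simps)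
    qed
  qed
  then show ?thesis using that by blast
qed

lemma occurs_at_subst:
  assumes st: "s \<noteq> t" and ne: "\<And>n. f n \<noteq> []"
    and f: "\<And>n. n \<in> {s, t} \<Longrightarrow> f n = [n] \<or> f n = [s, t]"
    and y: "sset y \<subseteq> {s, t}"
    and v: "v \<noteq> []" "hd v = s"
    and iff: "\<And>z. sset z \<subseteq> {s, t} \<Longrightarrow> is_prefix v (subst f z) \<longleftrightarrow> is_prefix v' z"
  shows "occurs_at v (subst f y) i \<longleftrightarrow>
    (\<exists>m. i = length (concat (map f (stake m y))) \<and> occurs_at v' y m)"
proof -
  have sub: "sset (sdrop m y) \<subseteq> {s, t}" for m
    using y by (metis (no_types, lifting) order_trans Un_upper2 sset_shift stake_sdrop)
  have at: "occurs_at v (subst f y) (length (concat (map f (stake m y)))) \<longleftrightarrow> occurs_at v' y m" for m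
    using iff[OF sub] sdrop_subst[of f, OF ne] by (simp add: occurs_at_def)
  show ?thesis
  proof
    assume occ: "occurs_at v (subst f y) i"
    obtain m q where mq: "i = length (concat (map f (stake m y))) + q" "q < length (f (y !! m))"
      using subst_position[of f, OF ne] by blast
    have "q = 0"
    proof (rule ccontr)
      assume "q \<noteq> 0"
      have "y !! m \<in> {s, t}" using y by (meson snth_sset subsetD)
      with \<open>q \<noteq> 0\<close> mq(2) f have fm: "f (y !! m) = [s, t]" "q = 1" by fastforce+
      have "sdrop i (subst f y) = sdrop q (subst f (sdrop m y))"
        unfolding mq(1) by (simp flip: sdrop_add add: sdrop_subst[of f, OF ne])
      also have "\<dots> = sdrop q ([s, t] @- subst f (sdrop (Suc m) y))"
        using ne fm(1) by (subst subst_unfold) auto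
      finally have "shd (sdrop i (subst f y)) = t" using fm(2) by simp
      moreover have "shd (sdrop i (subst f y)) = s"
        using occ v by (cases v) (auto simp: occurs_at_def is_prefix_Cons')
      ultimately show False using st by simp
    qed
    then show "\<exists>m. i = length (concat (map f (stake m y))) \<and> occurs_at v' y m"
      using mq occ at by auto
  qed (use at in auto)
qed

lemma return_words_subst:
  assumes ne: "\<And>n. f n \<noteq> []"
    and occ: "\<And>i. occurs_at v (subst f y) i \<longleftrightarrow>
      (\<exists>m. i = length (concat (map f (stake m y))) \<and> occurs_at v' y m)"
  shows "return_words (subst f y) v = (\<lambda>r. concat (map f r)) ` return_words y v'"
proof -
  define pos where "pos m = length (concat (map f (stake m y)))" for m
  have add: "pos (m + n) = pos m + length (concat (map f (stake n (sdrop m y))))" for m n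
    by (simp add: pos_def flip: stake_add)
  have mono: "strict_mono pos"
    unfolding strict_mono_Suc_iff using ne by (simp add: pos_def stake_Suc del: stake.simps)
  have less: "pos m < pos n \<longleftrightarrow> m < n" for m n
    using mono by (rule strict_mono_less)
  have occ': "occurs_at v (subst f y) i \<longleftrightarrow> (\<exists>m. i = pos m \<and> occurs_at v' y m)" for i
    using occ by (simp add: pos_def)
  have factor: "stake (pos n - pos m) (sdrop (pos m) (subst f y)) =
      concat (map f (stake (n - m) (sdrop m y)))" if "m < n" for m n
  proof -
    have "sdrop (pos m) (subst f y) = subst f (sdrop m y)"
      unfolding pos_def by (rule sdrop_subst[of f, OF ne])
    also have "\<dots> = concat (map f (stake (n - m) (sdrop m y))) @- subst f (sdrop (n - m) (sdrop m y))"
      by (metis ne stake_sdrop subst_shift)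
    finally show ?thesis using add[of m "n - m"] that by (simp add: stake_shift)
  qed
  show ?thesis
  proof (intro equalityI subsetI)
    fix r assume "r \<in> return_words (subst f y) v"
    then obtain i j where ij: "i < j" "occurs_at v (subst f y) i" "occurs_at v (subst f y) j"
      "\<forall>l. i < l \<and> l < j \<longrightarrow> \<not> occurs_at v (subst f y) l"
      and r: "r = stake (j - i) (sdrop i (subst f y))"
      unfolding return_words_def by blast
    then obtain m n where mn: "i = pos m" "j = pos n" "occurs_at v' y m" "occurs_at v' y n"
      using occ' by blast
    have "m < n" using ij(1) mn(1,2) less by simp
    moreover have "\<forall>l. m < l \<and> l < n \<longrightarrow> \<not> occurs_at v' y l"
      using ij(4) mn(1,2) less occ' by metis
    ultimately have "stake (n - m) (sdrop m y) \<in> return_words y v'"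
      using mn(3,4) unfolding return_words_def by blast
    then show "r \<in> (\<lambda>r. concat (map f r)) ` return_words y v'"
      using r factor[OF \<open>m < n\<close>] mn by (intro image_eqI) auto
  next
    fix r assume "r \<in> (\<lambda>r. concat (map f r)) ` return_words y v'"
    then obtain m n where mn: "m < n" "occurs_at v' y m" "occurs_at v' y n"
      "\<forall>l. m < l \<and> l < n \<longrightarrow> \<not> occurs_at v' y l"
      and r: "r = concat (map f (stake (n - m) (sdrop m y)))"
      unfolding return_words_def by blast
    have "r = stake (pos n - pos m) (sdrop (pos m) (subst f y))"
      using factor mn r by simp
    moreover have "pos m < pos n" using mn(1) less by simp
    moreover have "occurs_at v (subst f y) (pos m)" "occurs_at v (subst f y) (pos n)"
      using mn(2,3) occ' by metis+
    moreover have "\<forall>l. pos m < l \<and> l < pos n \<longrightarrow> \<not> occurs_at v (subst f y) l"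
    proof (intro allI impI notI)
      fix l assume l: "pos m < l \<and> l < pos n" and "occurs_at v (subst f y) l"
      then obtain k where "l = pos k" "occurs_at v' y k" using occ' by metis
      then show False using l less mn(4) by blast
    qed
    ultimately show "r \<in> return_words (subst f y) v"
      unfolding return_words_def mem_Collect_eq
      by - (rule exI[of _ "pos m"], rule exI[of _ "pos n"], simp)
  qed
qed

lemma return_words_nonempty: "r \<in> return_words u v \<Longrightarrow> r \<noteq> []"
  by (auto simp: return_words_def)

lemma return_words_subset: "r \<in> return_words u v \<Longrightarrow> set r \<subseteq> sset u"
  unfolding return_words_def
  by (auto simp: subset_iff) (metis UnCI sset_shift stake_sdrop)

lemma derivated_word_subst:
  assumes ne: "\<And>n. f n \<noteq> []"
    and occ: "\<And>i. occurs_at v (subst f y) i \<longleftrightarrow>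
      (\<exists>m. i = length (concat (map f (stake m y))) \<and> occurs_at v' y m)"
    and inj: "inj (\<lambda>xs. concat (map f xs))"
    and inj_subst: "\<And>z. sset z \<subseteq> sset y \<Longrightarrow> subst f y = subst f z \<Longrightarrow> y = z"
  shows "derivated_word (subst f y) v d \<longleftrightarrow> derivated_word y v' d"
proof -
  let ?F = "\<lambda>xs. concat (map f xs)"
  have ret: "return_words (subst f y) v = ?F ` return_words y v'"
    by (rule return_words_subst[OF ne occ])
  have key: "subst f y = subst (\<lambda>i. map ?F r ! i) d \<longleftrightarrow> y = subst (\<lambda>i. r ! i) d"
    if r: "set r = return_words y v'" and d: "sset d \<subseteq> {..<length r}" for r
  proof -
    have m: "r ! i \<in> return_words y v'" if "i \<in> sset d" for i
      using r d that by (metis lessThan_iff nth_mem subset_eq)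
    have "subst (\<lambda>i. map ?F r ! i) d = subst (\<lambda>i. ?F (r ! i)) d"
      using d by (intro subst_cong) auto
    also have "\<dots> = subst f (subst (\<lambda>i. r ! i) d)"
      using m return_words_nonempty by (intro subst_subst[symmetric] ne) blast
    finally have eq: "subst (\<lambda>i. map ?F r ! i) d = subst f (subst (\<lambda>i. r ! i) d)" .
    have "sset (subst (\<lambda>i. r ! i) d) \<subseteq> sset y"
      using m return_words_nonempty return_words_subset by (subst sset_subst) blast+
    then show ?thesis unfolding eq using inj_subst by metis
  qed
  show ?thesis
  proof
    assume "derivated_word (subst f y) v d"
    then obtain r where r: "distinct r" "set r = ?F ` return_words y v'" "sset d \<subseteq> {..<length r}"
      "subst f y = subst (\<lambda>i. r ! i) d"
      unfolding derivated_word_def ret subst_def[symmetric] by blast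
    define r' where "r' = map (inv_into (return_words y v') ?F) r"
    have rr: "r = map ?F r'"
      unfolding r'_def map_map using r(2) by (intro map_idI[symmetric]) (simp add: f_inv_into_f[of _ ?F])
    then have "distinct r'" "?F ` set r' = ?F ` return_words y v'"
      using r(1,2) by (auto simp: distinct_map)
    then have "set r' = return_words y v'" using inj by (simp add: inj_image_eq_iff)
    then show "derivated_word y v' d"
      using \<open>distinct r'\<close> r(3,4) key[of r'] unfolding derivated_word_def rr subst_def[symmetric]
      by (intro exI[of _ r']) auto
  next
    assume "derivated_word y v' d"
    then obtain r where r: "distinct r" "set r = return_words y v'" "sset d \<subseteq> {..<length r}"
      "y = subst (\<lambda>i. r ! i) d"
      unfolding derivated_word_def subst_def[symmetric] by blast
    then show "derivated_word (subst f y) v d"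
      using key[of r] inj unfolding derivated_word_def ret subst_def[symmetric]
      by (intro exI[of _ "map ?F r"]) (auto simp: distinct_map intro: inj_on_subset[OF inj])
  qed
qed

lemma inj_subst_before:
  assumes "s \<noteq> t" "sset y \<subseteq> {s, t}" "sset z \<subseteq> {s, t}" "subst (before s t) y = subst (before s t) z"
  shows "y = z"
  using assms prefix_before_iff[OF assms(1)] by (intro stream_eqI_prefix) metis

lemma inj_subst_after:
  assumes "s \<noteq> t" "sset y \<subseteq> {s, t}" "sset z \<subseteq> {s, t}" "subst (after s t) y = subst (after s t) z"
  shows "y = z"
  using assms prefix_after_iff[OF assms(1)] by (intro stream_eqI_prefix) metis

lemma is_prefix_hd: "is_prefix v x \<Longrightarrow> v \<noteq> [] \<Longrightarrow> hd v = shd x"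
  by (cases v) (auto simp: is_prefix_Cons')

lemma shd_subst: "f (shd x) \<noteq> [] \<Longrightarrow> shd (subst f x) = hd (f (shd x))"
  by (subst subst_unfold) auto

lemma derivated_word_before:
  assumes st: "s \<noteq> t" and y: "sset y \<subseteq> {s, t}" and v: "v \<noteq> []" "is_prefix v (subst (before s t) y)"
    and iff: "\<And>z. sset z \<subseteq> {s, t} \<Longrightarrow> is_prefix v (subst (before s t) z) \<longleftrightarrow> is_prefix v' z"
  shows "derivated_word (subst (before s t) y) v d \<longleftrightarrow> derivated_word y v' d"
proof (rule derivated_word_subst[OF before_nonempty _ inj_concat_before[OF st]])
  have "shd y \<in> {s, t}" using y by (meson shd_sset subsetD)
  then have "hd v = s" using is_prefix_hd[OF v(2,1)] st by (auto simp: shd_subst before_def)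
  then show "occurs_at v (subst (before s t) y) i \<longleftrightarrow>
    (\<exists>m. i = length (concat (map (before s t) (stake m y))) \<and> occurs_at v' y m)" for i
    using y v iff by (intro occurs_at_subst[OF st before_nonempty]) (simp_all, simp add: before_def)
qed (use inj_subst_before[OF st y] y in blast)

lemma derivated_word_after:
  assumes st: "s \<noteq> t" and y: "sset y \<subseteq> {s, t}" "shd y = s"
    and v: "v \<noteq> []" "is_prefix v (subst (after s t) y)"
    and iff: "\<And>z. sset z \<subseteq> {s, t} \<Longrightarrow> is_prefix v (subst (after s t) z) \<longleftrightarrow> is_prefix v' z"
  shows "derivated_word (subst (after s t) y) v d \<longleftrightarrow> derivated_word y v' d"
proof (rule derivated_word_subst[OF after_nonempty _ inj_concat_after[OF st]])
  have "hd v = s" using is_prefix_hd[OF v(2,1)] st y(2) by (auto simp: shd_subst)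
  then show "occurs_at v (subst (after s t) y) i \<longleftrightarrow>
    (\<exists>m. i = length (concat (map (after s t) (stake m y))) \<and> occurs_at v' y m)" for i
    using y v iff by (intro occurs_at_subst[OF st after_nonempty]) (simp_all, auto simp: after_def)
qed (use inj_subst_after[OF st y(1)] y(1) in blast)

text \<open>Covers both \<open>\<alpha>\<^sup>k b\<close> (\<open>s = 0\<close>) and \<open>a\<^sup>k \<beta>\<close> (\<open>s = 1\<close>).\<close>

definition block :: "'a \<Rightarrow> 'a \<Rightarrow> nat \<Rightarrow> 'a stream \<Rightarrow> 'a stream" where
  "block s t k y = (subst (after s t) ^^ k) (subst (before s t) y)"

lemma block_properties:
  assumes "s \<noteq> t" "sset y \<subseteq> {s, t}"
  shows "sset (block s t k y) \<subseteq> {s, t} \<and> shd (block s t k y) = s"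
proof (induction k)
  case 0
  have "shd y \<in> {s, t}" using assms(2) by (meson shd_sset subsetD)
  moreover have "sset (subst (before s t) y) \<subseteq> {s, t}"
    using assms(2) by (subst sset_subst) (auto simp: before_def split: if_splits)
  ultimately show ?case using assms(1) by (auto simp: block_def shd_subst before_def)
next
  case (Suc k)
  have "sset (subst (after s t) (block s t k y)) \<subseteq> {s, t}"
    using Suc by (subst sset_subst) (auto simp: after_def split: if_splits)
  then show ?case using Suc assms(1) by (auto simp: block_def shd_subst)
qed

lemma desubst_block:
  assumes st: "s \<noteq> t" and y: "sset y \<subseteq> {s, t}" and v: "v \<noteq> []" "is_prefix v (block s t k y)"
  shows "\<exists>v'. is_prefix v' y \<and> length v' < length v \<and>
    (\<forall>d. derivated_word (block s t k y) v d \<longleftrightarrow> derivated_word y v' d)"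
  using v
proof (induction k arbitrary: v)
  case 0
  then obtain v' where "is_prefix v' y" "length v' < length v"
    "\<And>z. sset z \<subseteq> {s, t} \<Longrightarrow> is_prefix v (subst (before s t) z) \<longleftrightarrow> is_prefix v' z"
    using desubst_prefix_before[OF st y, of v] by (auto simp: block_def)
  then show ?case using derivated_word_before[OF st y, of v v'] 0 by (auto simp: block_def)
next
  case (Suc k)
  let ?z = "block s t k y"
  have z: "sset ?z \<subseteq> {s, t}" "shd ?z = s" using block_properties[OF st y] by auto
  have Suc_block: "block s t (Suc k) y = subst (after s t) ?z" by (simp add: block_def)
  obtain v1 where v1: "is_prefix v1 ?z" "length v1 \<le> length v" "v1 \<noteq> []"
    "\<And>z. sset z \<subseteq> {s, t} \<Longrightarrow> is_prefix v (subst (after s t) z) \<longleftrightarrow> is_prefix v1 z"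
    using desubst_prefix_after[OF st z(1), of v] Suc.prems unfolding Suc_block by auto
  obtain v' where "is_prefix v' y" "length v' < length v1"
    "\<forall>d. derivated_word ?z v1 d \<longleftrightarrow> derivated_word y v' d"
    using Suc.IH[OF v1(3,1)] by blast
  moreover have "derivated_word (block s t (Suc k) y) v d \<longleftrightarrow> derivated_word ?z v1 d" for d
    using derivated_word_after[OF st z, of v v1] Suc.prems v1(4) unfolding Suc_block by blast
  ultimately show ?case using v1(2) by (intro exI[of _ v']) auto
qed

lemma subst_block:
  assumes st: "s \<noteq> t" and y: "sset y \<subseteq> {s, t}" and v': "is_prefix v' y"
  shows "\<exists>v. v \<noteq> [] \<and> is_prefix v (block s t k y) \<and>
    (\<forall>d. derivated_word (block s t k y) v d \<longleftrightarrow> derivated_word y v' d)"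
proof (induction k)
  case 0
  show ?case
    using derivated_word_before[OF st y _ _ prefix_before_iff[OF st], of v'] prefix_before_iff[OF st y] v'
    unfolding block_def funpow_0
    by - (rule exI[of _ "concat (map (before s t) v') @ [s]"], simp)
next
  case (Suc k)
  let ?z = "block s t k y"
  have z: "sset ?z \<subseteq> {s, t}" "shd ?z = s" using block_properties[OF st y] by auto
  have Suc_block: "block s t (Suc k) y = subst (after s t) ?z" by (simp add: block_def)
  obtain v where v: "v \<noteq> []" "is_prefix v ?z"
    "\<forall>d. derivated_word ?z v d \<longleftrightarrow> derivated_word y v' d"
    using Suc.IH by blast
  let ?w = "concat (map (after s t) v)"
  have w: "?w \<noteq> []" "is_prefix ?w (subst (after s t) ?z)"
    using v prefix_after_iff[OF st z(1)] by (auto simp: neq_Nil_conv)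
  have "derivated_word (subst (after s t) ?z) ?w d \<longleftrightarrow> derivated_word ?z v d" for d
    by (rule derivated_word_after[OF st z w prefix_after_iff[OF st]])
  then show ?case using w v(3) unfolding Suc_block by blast
qed

lemma eq_up_to_perm_iff:
  "eq_up_to_perm x y \<longleftrightarrow> x = y \<or> x = smap (transpose 0 1) y"
proof -
  have "eq_up_to_perm x y \<longleftrightarrow> x = smap id y \<or> x = smap (transpose 0 1) y"
    unfolding eq_up_to_perm_def permutes_doubleton_iff by blast
  then show ?thesis by (simp only: stream.map_id)
qed

lemma return_words_Nil: "return_words u [] = (\<lambda>a. [a]) ` sset u"
proof -
  have "return_words u [] = {stake 1 (sdrop i u) | i. True}"
    unfolding return_words_def occurs_at_def
  proof (intro Collect_cong iffI; clarsimp)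
    fix i j :: nat assume "i < j" "\<forall>l>i. \<not> l < j"
    then have "j = Suc i" by (metis Suc_lessI lessI)
    then show "\<exists>i'. stake (j - i) (sdrop i u) = [u !! i']" by auto
  next
    fix i show "\<exists>i' j. [u !! i] = stake (j - i') (sdrop i' u) \<and> i' < j \<and> (\<forall>l>i'. \<not> l < j)"
      by (intro exI[of _ i] exI[of _ "Suc i"]) auto
  qed
  also have "\<dots> = (\<lambda>a. [a]) ` sset u" by (auto simp: sset_range)
  finally show ?thesis .
qed

lemma smap_transpose_transpose: "smap (transpose a b) (smap (transpose a b) x) = x"
  by (simp add: stream.map_comp stream.map_id)

lemma derivated_word_Nil:
  assumes u: "sset u = {0, 1}"
  shows "derivated_word u [] d \<longleftrightarrow> eq_up_to_perm u d \<and> sset d \<subseteq> {0, 1}"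
proof -
  let ?T = "transpose 0 (1 :: nat)"
  have enum: "distinct r \<and> set r = {[0], [1]} \<longleftrightarrow> r = [[0], [1]] \<or> r = [[1], [0 :: nat]]"
    for r :: "nat list list"
  proof
    assume r: "distinct r \<and> set r = {[0], [1]}"
    then have "length r = 2" using distinct_card[of r] by simp
    then obtain a b where "r = [a, b]" by (auto simp: numeral_2_eq_2 length_Suc_conv)
    then show "r = [[0], [1]] \<or> r = [[1], [0]]" using r by (auto simp: doubleton_eq_iff)
  qed auto
  have bound: "sset d \<subseteq> {..<length r} \<longleftrightarrow> sset d \<subseteq> {0, 1}" if "length r = 2" for r :: "nat list list"
    using that by (simp add: lessThan_nat_numeral numeral_2_eq_2 lessThan_Suc insert_commute)
  have id: "subst (\<lambda>i. [[0], [1 :: nat]] ! i) d = d" if "sset d \<subseteq> {0, 1}"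
  proof -
    have "subst (\<lambda>i. [[0], [1 :: nat]] ! i) d = subst (\<lambda>i. [id i]) d"
      using that by (intro subst_cong) auto
    then show ?thesis by (simp only: subst_singleton stream.map_id)
  qed
  have tr: "subst (\<lambda>i. [[1], [0 :: nat]] ! i) d = smap ?T d" if "sset d \<subseteq> {0, 1}"
  proof -
    have "subst (\<lambda>i. [[1], [0 :: nat]] ! i) d = subst (\<lambda>i. [?T i]) d"
      using that by (intro subst_cong) (auto simp: transpose_def)
    then show ?thesis by (simp only: subst_singleton)
  qed
  have "derivated_word u [] d \<longleftrightarrow> (\<exists>r. (r = [[0], [1]] \<or> r = [[1], [0]]) \<and>
      (sset d \<subseteq> {..<length r} \<and> u = subst (\<lambda>i. r ! i) d))"
    unfolding derivated_word_def return_words_Nil u subst_def enum[symmetric] by (simp add: conj_assoc)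
  also have "\<dots> \<longleftrightarrow> (sset d \<subseteq> {..<length [[0], [1 :: nat]]} \<and> u = subst (\<lambda>i. [[0], [1]] ! i) d) \<or>
      (sset d \<subseteq> {..<length [[1], [0 :: nat]]} \<and> u = subst (\<lambda>i. [[1], [0]] ! i) d)"
    by blast
  also have "\<dots> \<longleftrightarrow> sset d \<subseteq> {0, 1} \<and> (u = d \<or> u = smap ?T d)"
  proof (cases "sset d \<subseteq> {0, 1}")
    case True
    then show ?thesis using True id[OF True] tr[OF True] bound[of "[[0], [1]]"] bound[of "[[1], [0]]"] by simp
  next
    case False
    then show ?thesis using bound[of "[[0], [1]]"] bound[of "[[1], [0]]"] by simp
  qed
  finally show ?thesis by (auto simp: eq_up_to_perm_iff)
qed

lemma derivated_word_Nil_eq_up_to_perm: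
  assumes u: "sset u = {0, 1}"
  shows "(\<exists>d. derivated_word u [] d \<and> eq_up_to_perm x d) \<longleftrightarrow> eq_up_to_perm x u"
proof
  assume "\<exists>d. derivated_word u [] d \<and> eq_up_to_perm x d"
  then show "eq_up_to_perm x u"
    unfolding derivated_word_Nil[OF u] eq_up_to_perm_iff by (auto simp: smap_transpose_transpose)
next
  assume "eq_up_to_perm x u"
  then show "\<exists>d. derivated_word u [] d \<and> eq_up_to_perm x d"
    unfolding derivated_word_Nil[OF u] using u by (intro exI[of _ u]) (auto simp: eq_up_to_perm_iff)
qed

section \<open>Names and their normalization\<close>

lemma gen_letter_nonempty [simp]: "gen_letter c i \<noteq> []"
  by (cases c) auto

lemma gen_morph_append: "gen_morph c (xs @ ys) = gen_morph c xs @ gen_morph c ys"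
  by (simp add: gen_morph_def)

lemma phi_Nil [simp]: "phi [] xs = xs"
  by (simp add: phi_def)

lemma phi_Cons [simp]: "phi (c # w) xs = gen_morph c (phi w xs)"
  by (simp add: phi_def)

lemma phi_append: "phi (v @ w) xs = phi v (phi w xs)"
  by (induction v) auto

lemma phi_concat: "phi w (concat xss) = concat (map (phi w) xss)"
proof (induction w)
  case (Cons c w)
  have "gen_morph c (concat yss) = concat (map (gen_morph c) yss)" for yss
    by (induction yss) (auto simp: gen_morph_append, simp add: gen_morph_def)
  then show ?case using Cons by (simp add: comp_def)
qed (simp add: map_idI)

lemma phi_hom: "phi w (xs @ ys) = phi w xs @ phi w ys"
  using phi_concat[of w "[xs, ys]"] by simp

lemma phi_letters: "phi w xs = concat (map (\<lambda>i. phi w [i]) xs)"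
  using phi_concat[of w "map (\<lambda>i. [i]) xs"] by (simp add: comp_def)

lemma phi_nonempty: "xs \<noteq> [] \<Longrightarrow> phi w xs \<noteq> []"
proof (induction w)
  case (Cons c w)
  then show ?case by (cases "phi w xs") (auto simp: gen_morph_def)
qed simp

lemma set_phi: "set xs \<subseteq> {0, 1} \<Longrightarrow> set (phi w xs) \<subseteq> {0, 1}"
proof (induction w)
  case (Cons c w)
  have letter: "set (gen_letter c i) \<subseteq> {0, 1}" if "i \<in> {0, 1}" for i
    using that by (cases c) auto
  have "set (phi (c # w) xs) = (\<Union>i\<in>set (phi w xs). set (gen_letter c i))"
    by (simp add: gen_morph_def)
  also have "\<dots> \<subseteq> {0, 1}" using Cons letter by (intro UN_least) (meson subsetD)
  finally show ?case .
qed simp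

lemma set_phi_full: "{0, 1} \<subseteq> set xs \<Longrightarrow> {0, 1} \<subseteq> set (phi w xs)"
proof (induction w)
  case (Cons c w)
  then show ?case by (cases c) (auto simp: gen_morph_def split: if_splits)
qed simp

lemma phi_eqI:
  assumes "\<And>i. phi v [i] = phi w [i]"
  shows "phi v = phi w"
proof
  fix xs
  have "phi v xs = concat (map (\<lambda>i. phi v [i]) xs)" by (rule phi_letters)
  also have "\<dots> = concat (map (\<lambda>i. phi w [i]) xs)" using assms by simp
  also have "\<dots> = phi w xs" by (rule phi_letters[symmetric])
  finally show "phi v xs = phi w xs" .
qed

lemma phi_funpow: "phi w ^^ n = phi (concat (replicate n w))"
  by (induction n) (auto simp: phi_append)

lemma special_morphisms_eq: "special_morphisms = range phi"
proof (intro equalityI subsetI)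
  fix \<psi> assume "\<psi> \<in> special_morphisms"
  then show "\<psi> \<in> range phi"
  proof induction
    case special_id
    show ?case by (rule range_eqI[of _ _ "[]"]) auto
  next
    case (special_step \<psi> c)
    then obtain w where "\<psi> = phi w" by blast
    then show ?case by (intro range_eqI[of _ _ "c # w"]) auto
  qed
next
  fix \<psi> assume "\<psi> \<in> range phi"
  then obtain w where "\<psi> = phi w" by blast
  then show "\<psi> \<in> special_morphisms"
  proof (induction w arbitrary: \<psi>)
    case Nil
    have "phi [] = id" by (rule ext) simp
    then show ?case using special_id Nil by metis
  next
    case (Cons c w)
    have "phi (c # w) = gen_morph c \<circ> phi w" by (rule ext) simp
    then show ?case using special_step[OF Cons.IH[OF refl], of c] Cons.prems by metis
  qed
qed

lemma gen_morph_simps [simp]: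
  "gen_morph c [] = []"
  "gen_morph c (i # xs) = gen_letter c i @ gen_morph c xs"
  by (simp_all add: gen_morph_def)

lemma phi_replicate_LA: "phi (replicate k LA) [i] = (if i = 1 then 1 # replicate k 0 else [i])"
proof (induction k)
  case (Suc k)
  have "gen_morph LA (replicate k 0) = replicate k 0" for k by (induction k) auto
  with Suc show ?case by auto
qed simp

lemma phi_replicate_LB: "phi (replicate k LB) [i] = (if i = 1 then replicate k 0 @ [1] else [i])"
proof (induction k)
  case (Suc k)
  have "gen_morph LB (replicate k 0) = replicate k 0" for k by (induction k) auto
  with Suc show ?case by (auto simp: gen_morph_append replicate_app_Cons_same replicate_append_same)
qed simp

lemma phi_replicate_Alpha: "phi (replicate k Alpha) [i] = (if i = 0 then 0 # replicate k 1 else [i])"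
proof (induction k)
  case (Suc k)
  have "gen_morph Alpha (replicate k 1) = replicate k 1" for k by (induction k) auto
  with Suc show ?case by auto
qed simp

lemma phi_replicate_Beta: "phi (replicate k Beta) [i] = (if i = 0 then replicate k 1 @ [0] else [i])"
proof (induction k)
  case (Suc k)
  have "gen_morph Beta (replicate k 1) = replicate k 1" for k by (induction k) auto
  with Suc show ?case by (auto simp: gen_morph_append replicate_app_Cons_same replicate_append_same)
qed simp

lemma gen_morph_replicate:
  "gen_morph Alpha (replicate k 0) @ [0] = 0 # gen_morph Beta (replicate k 0)"
  "1 # gen_morph Alpha (replicate k 0) = gen_morph Beta (replicate k 0) @ [1]"
  "gen_morph LA (replicate k 1) @ [1] = 1 # gen_morph LB (replicate k 1)"
  "0 # gen_morph LA (replicate k 1) = gen_morph LB (replicate k 1) @ [0]"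
proof (induction k)
  case (Suc k)
  { case 1 show ?case using Suc.IH(1) by simp }
  { case 2 show ?case using Suc.IH(1,2) by simp }
  { case 3 show ?case using Suc.IH(3) by simp }
  { case 4 show ?case using Suc.IH(3,4) by simp }
qed simp_all

lemma phi_greek:
  "phi ([Alpha] @ replicate k LA @ [Beta]) = phi ([Beta] @ replicate k LB @ [Alpha])"
proof (rule phi_eqI)
  fix i :: nat
  have cons: "phi w (a # b # xs) = phi w [a] @ phi w (b # xs)" for w a b xs
    using phi_hom[of w "[a]" "b # xs"] by simp
  show "phi ([Alpha] @ replicate k LA @ [Beta]) [i] = phi ([Beta] @ replicate k LB @ [Alpha]) [i]"
    using gen_morph_replicate[of k]
    by (auto simp: phi_append cons phi_replicate_LA phi_replicate_LB gen_morph_append)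
qed

lemma phi_latin:
  "phi ([LA] @ replicate k Alpha @ [LB]) = phi ([LB] @ replicate k Beta @ [LA])"
proof (rule phi_eqI)
  fix i :: nat
  have cons: "phi w (a # b # xs) = phi w [a] @ phi w (b # xs)" for w a b xs
    using phi_hom[of w "[a]" "b # xs"] by simp
  show "phi ([LA] @ replicate k Alpha @ [LB]) [i] = phi ([LB] @ replicate k Beta @ [LA]) [i]"
    using gen_morph_replicate[of k]
    by (auto simp: phi_append cons phi_replicate_Alpha phi_replicate_Beta gen_morph_append)
qed

lemma phi_rewrite: "name_rewrite v w \<Longrightarrow> phi v = phi w"
proof (induction rule: name_rewrite.induct)
  case (greek x k y)
  show ?case using fun_cong[OF phi_greek[of k]] by (auto simp: phi_append)
next
  case (latin x k y)
  show ?case using fun_cong[OF phi_latin[of k]] by (auto simp: phi_append)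
qed

lemma phi_equiv: "equivclp name_rewrite v w \<Longrightarrow> phi v = phi w"
  by (induction rule: equivclp_induct) (auto dest: phi_rewrite)

definition is_latin :: "gen \<Rightarrow> bool" where
  "is_latin c \<longleftrightarrow> c = LA \<or> c = LB"

lemma equiv_shape: "equivclp name_rewrite v w \<Longrightarrow> map is_latin v = map is_latin w"
proof (induction rule: equivclp_induct)
  case (step y z)
  have "map is_latin a = map is_latin b" if "name_rewrite a b" for a b
    using that by induction (auto simp: is_latin_def)
  then show ?case using step by metis
qed simp

lemma name_less_total:
  "map is_latin v = map is_latin w \<Longrightarrow> v = w \<or> name_less v w \<or> name_less w v"
proof (induction v arbitrary: w)
  case (Cons c v)
  then obtain d w' where w: "w = d # w'" by (cases w) auto
  have "c = d \<or> (c, d) \<in> {(LA, LB), (Alpha, Beta)} \<or> (d, c) \<in> {(LA, LB), (Alpha, Beta)}"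
    using Cons.prems unfolding w by (cases c; cases d) (auto simp: is_latin_def)
  then show ?case using Cons.IH[of w'] Cons.prems unfolding w name_less_def by auto
qed simp

lemma name_less_trans: "name_less u v \<Longrightarrow> name_less v w \<Longrightarrow> name_less u w"
  unfolding name_less_def by (erule (1) lexord_trans) (auto simp: trans_def)

lemma name_less_irrefl: "\<not> name_less v v"
  unfolding name_less_def by (rule lexord_irreflexive) auto

lemma normalize_spec:
  "equivclp name_rewrite w (normalize w) \<and>
    (\<forall>v. equivclp name_rewrite w v \<longrightarrow> v = normalize w \<or> name_less v (normalize w))"
proof -
  let ?C = "{v. equivclp name_rewrite w v}"
  have "finite {xs :: gen list. set xs \<subseteq> {LA, LB, Alpha, Beta} \<and> length xs = length w}"
    by (rule finite_lists_length_eq) simp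
  moreover have "c \<in> {LA, LB, Alpha, Beta}" for c by (cases c) auto
  then have "?C \<subseteq> {xs. set xs \<subseteq> {LA, LB, Alpha, Beta} \<and> length xs = length w}"
    using equiv_shape map_eq_imp_length_eq by (metis (mono_tags, lifting) mem_Collect_eq subsetI)
  ultimately have fin: "finite ?C" by (rule rev_finite_subset)
  have "\<exists>m\<in>C. \<forall>v\<in>C. v = m \<or> name_less v m" if "finite C" "C \<noteq> {}" "C \<subseteq> ?C" for C
    using that
  proof (induction rule: finite_ne_induct)
    case (singleton x)
    then show ?case by simp
  next
    case (insert x C)
    then obtain m where m: "m \<in> C" "\<forall>v\<in>C. v = m \<or> name_less v m" by auto
    have "map is_latin x = map is_latin m"
      using insert.prems m(1) equiv_shape by (metis (no_types, lifting) insert_subset mem_Collect_eq subset_iff)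
    then consider "x = m" | "name_less x m" | "name_less m x" using name_less_total by blast
    then show ?case
    proof cases
      case 1
      then show ?thesis using m by (intro bexI[of _ m]) auto
    next
      case 2
      then show ?thesis using m by (intro bexI[of _ m]) auto
    next
      case 3
      have "name_less v x" if "v \<in> C" for v
        using m(2) that 3 name_less_trans[of v m x] by auto
      then show ?thesis by (intro bexI[of _ x]) auto
    qed
  qed
  from this[OF fin] obtain m where m: "equivclp name_rewrite w m"
    "\<forall>v. equivclp name_rewrite w v \<longrightarrow> v = m \<or> name_less v m"
    by (auto simp: equivclp_def)
  have uniq: "v = m" if "equivclp name_rewrite w v"
    "\<forall>v'. equivclp name_rewrite w v' \<longrightarrow> v' = v \<or> name_less v' v" for v
    using that(1) that(2)[rule_format, OF m(1)] m(2) name_less_trans[of v m v] name_less_irrefl[of v]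
    by auto
  have "normalize w = m"
    unfolding normalize_def
  proof (rule the_equality)
    show "equivclp name_rewrite w m \<and>
        (\<forall>v'. equivclp name_rewrite w v' \<longrightarrow> v' = m \<or> name_less v' m)"
      using m by blast
  next
    fix v assume "equivclp name_rewrite w v \<and>
        (\<forall>v'. equivclp name_rewrite w v' \<longrightarrow> v' = v \<or> name_less v' v)"
    then show "v = m" by (intro uniq) blast+
  qed
  then show ?thesis using m by simp
qed

lemma phi_normalize: "phi (normalize w) = phi w"
  using normalize_spec phi_equiv by metis

lemma phi_normal_name: "\<psi> \<in> special_morphisms \<Longrightarrow> phi (normal_name \<psi>) = \<psi>"
  unfolding normal_name_def phi_normalize special_morphisms_eq by (rule someI_ex) auto

lemma normalize_no_increase:
  assumes "name_rewrite (normalize w) v"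
  shows "\<not> name_less (normalize w) v"
proof -
  have "equivclp name_rewrite w v"
    using assms normalize_spec by (meson equivclp_trans r_into_equivclp)
  then have "v = normalize w \<or> name_less v (normalize w)" using normalize_spec by blast
  then show ?thesis
    using name_less_trans[of "normalize w" v "normalize w"] name_less_irrefl by auto
qed

lemma normalize_head:
  assumes "\<not> set (normalize w) \<subseteq> {LA, Alpha}"
  obtains k w' where "normalize w = replicate k LA @ [Beta] @ w'"
  | k w' where "normalize w = replicate k Alpha @ [LB] @ w'"
proof -
  obtain z c w' where z: "normalize w = z @ c # w'" "c \<notin> {LA, Alpha}" "set z \<subseteq> {LA, Alpha}"
    using split_list_first_prop[of "normalize w" "\<lambda>c. c \<notin> {LA, Alpha}"] assms by blast
  have tail: "\<exists>z1 k. z = z1 @ [c'] @ replicate k d" if c': "c' \<in> set z" "set z \<subseteq> {c', d}" for c' d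
  proof -
    obtain z1 z2 where z: "z = z1 @ c' # z2" "c' \<notin> set z2" using split_list_last[OF c'(1)] by blast
    then have "z2 = replicate (length z2) d" using c'(2) by (intro replicate_eqI) auto
    then show ?thesis using z(1) by (metis append_Cons append_Nil)
  qed
  consider "c = Beta" | "c = LB" using z(2) by (cases c) auto
  then show thesis
  proof cases
    case 1
    have "Alpha \<notin> set z"
    proof
      assume "Alpha \<in> set z"
      then obtain z1 k where "z = z1 @ [Alpha] @ replicate k LA" using tail[of Alpha LA] z(3) by auto
      then have n: "normalize w = z1 @ [Alpha] @ replicate k LA @ [Beta] @ w'" using z 1 by simp
      have "name_rewrite (normalize w) (z1 @ [Beta] @ replicate k LB @ [Alpha] @ w')"
        unfolding n by (rule greek)
      moreover have "name_less (normalize w) (z1 @ [Beta] @ replicate k LB @ [Alpha] @ w')"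
        unfolding n name_less_def by (simp add: lexord_append_left_rightI)
      ultimately show False using normalize_no_increase by blast
    qed
    then have "z = replicate (length z) LA" using z(3) by (intro replicate_eqI) auto
    then show thesis using that(1) z(1) 1 by (metis append_Cons append_Nil)
  next
    case 2
    have "LA \<notin> set z"
    proof
      assume "LA \<in> set z"
      then obtain z1 k where "z = z1 @ [LA] @ replicate k Alpha" using tail[of LA Alpha] z(3) by auto
      then have n: "normalize w = z1 @ [LA] @ replicate k Alpha @ [LB] @ w'" using z 2 by simp
      have "name_rewrite (normalize w) (z1 @ [LB] @ replicate k Beta @ [LA] @ w')"
        unfolding n by (rule latin)
      moreover have "name_less (normalize w) (z1 @ [LB] @ replicate k Beta @ [LA] @ w')"
        unfolding n name_less_def by (simp add: lexord_append_left_rightI)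
      ultimately show False using normalize_no_increase by blast
    qed
    then have "z = replicate (length z) Alpha" using z(3) by (intro replicate_eqI) auto
    then show thesis using that(2) z(1) 2 by (metis append_Cons append_Nil)
  qed
qed

lemma replicate_append_inject:
  assumes "replicate k c @ d # w = replicate l c' @ d' # w'"
    and "d \<notin> {c, c'}" "d' \<notin> {c, c'}"
  shows "d = d' \<and> k = l \<and> w = w'"
  using assms
proof (induction k arbitrary: l)
  case 0
  then show ?case by (cases l) auto
next
  case (Suc k)
  then show ?case by (cases l) auto
qed

lemma Delta_name_Beta:
  "Delta_name (replicate k LA @ [Beta] @ w') = normalize (w' @ replicate k LA @ [Beta])"
proof -
  have "replicate k LA @ Beta # w' = replicate l LA @ Beta # v \<longleftrightarrow> l = k \<and> v = w'"
    "replicate k LA @ Beta # w' \<noteq> replicate l Alpha @ LB # v" for l v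
    by (auto dest!: replicate_append_inject)
  then show ?thesis by (simp add: Delta_name_def)
qed

lemma Delta_name_LB:
  "Delta_name (replicate k Alpha @ [LB] @ w') = normalize (w' @ replicate k Alpha @ [LB])"
proof -
  have "replicate k Alpha @ LB # w' = replicate l Alpha @ LB # v \<longleftrightarrow> l = k \<and> v = w'"
    "replicate k Alpha @ LB # w' \<noteq> replicate l LA @ Beta # v" for l v
    by (auto dest!: replicate_append_inject)
  then show ?thesis by (simp add: Delta_name_def)
qed

lemma hd_phi_not_collapsing:
  assumes "set w \<subseteq> {LA, Alpha}"
  shows "hd (phi w [i]) = i"
  using assms
proof (induction w)
  case (Cons c w)
  obtain xs where "phi w [i] = i # xs"
    using Cons phi_nonempty[of "[i]" w] by (cases "phi w [i]") auto
  then show ?case using Cons.prems by auto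
qed simp

lemma hd_phi_collapsing:
  assumes "\<not> set w \<subseteq> {LA, Alpha}"
  shows "hd (phi w [0]) = hd (phi w [1])"
  using assms
proof (induction w)
  case (Cons c w)
  obtain i xs j ys where ij: "phi w [0] = i # xs" "phi w [1] = j # ys"
    using phi_nonempty[of "[0]" w] phi_nonempty[of "[1]" w] by (meson list.exhaust not_Cons_self2)
  have bin: "i \<in> {0, 1}" "j \<in> {0, 1}"
    using set_phi[of "[0]" w] set_phi[of "[1]" w] ij by auto
  show ?case
  proof (cases "set w \<subseteq> {LA, Alpha}")
    case True
    then have "c = LB \<or> c = Beta" using Cons.prems by (cases c) auto
    then show ?thesis using ij bin by auto
  next
    case False
    then show ?thesis using Cons.IH ij by simp
  qed
qed simp

lemma collapsing_iff: "\<not> set w \<subseteq> {LA, Alpha} \<longleftrightarrow> hd (phi w [0]) = hd (phi w [1])"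
  using hd_phi_collapsing hd_phi_not_collapsing by (metis zero_neq_one)

section \<open>Fixed points and the map Delta\<close>

definition Phi :: "gen list \<Rightarrow> nat stream \<Rightarrow> nat stream" where
  "Phi w = subst (\<lambda>i. phi w [i])"

lemma fixed_point_phi: "fixed_point (phi w) x \<longleftrightarrow> sset x \<subseteq> {0, 1} \<and> Phi w x = x"
  by (simp add: fixed_point_def Phi_def subst_def)

lemma Phi_append: "Phi (v @ w) x = Phi v (Phi w x)"
  unfolding Phi_def
  by (subst subst_subst) (simp_all add: phi_nonempty phi_append flip: phi_letters)

lemma Phi_shift: "Phi w (xs @- x) = phi w xs @- Phi w x"
  unfolding Phi_def by (subst subst_shift) (simp_all add: phi_nonempty flip: phi_letters)

lemma sset_Phi: "sset (Phi w x) = (\<Union>i\<in>sset x. set (phi w [i]))"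
  unfolding Phi_def by (rule sset_subst) (simp add: phi_nonempty)

lemma sset_Phi_subset:
  assumes "sset x \<subseteq> {0, 1}"
  shows "sset (Phi w x) \<subseteq> {0, 1}"
proof -
  have "set (phi w [i]) \<subseteq> {0, 1}" if "i \<in> sset x" for i
    using that assms by (intro set_phi) auto
  then show ?thesis unfolding sset_Phi by (rule UN_least)
qed

lemma Phi_block_Beta: "Phi (replicate k LA @ [Beta]) y = block 1 0 k y"
proof (induction k)
  case 0
  have "(\<lambda>i. phi [Beta] [i]) = before 1 0" by (auto simp: before_def)
  then show ?case by (simp add: Phi_def block_def)
next
  case (Suc k)
  have "(\<lambda>i. phi [LA] [i]) = after 1 0" by (auto simp: after_def)
  then have "Phi [LA] x = subst (after 1 0) x" for x by (simp add: Phi_def)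
  then show ?case using Suc Phi_append[of "[LA]" "replicate k LA @ [Beta]" y]
    by (simp add: block_def)
qed

lemma Phi_block_LB: "Phi (replicate k Alpha @ [LB]) y = block 0 1 k y"
proof (induction k)
  case 0
  have "(\<lambda>i. phi [LB] [i]) = before 0 1" by (auto simp: before_def)
  then show ?case by (simp add: Phi_def block_def)
next
  case (Suc k)
  have "(\<lambda>i. phi [Alpha] [i]) = after 0 1" by (auto simp: after_def)
  then have "Phi [Alpha] x = subst (after 0 1) x" for x by (simp add: Phi_def)
  then show ?case using Suc Phi_append[of "[Alpha]" "replicate k Alpha @ [LB]" y]
    by (simp add: block_def)
qed

lemma fixed_point_rotate:
  assumes "fixed_point (phi (p @ w)) u"
  shows "fixed_point (phi (w @ p)) (Phi w u)" and "u = Phi p (Phi w u)"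
proof -
  have u: "sset u \<subseteq> {0, 1}" "Phi p (Phi w u) = u"
    using assms by (simp_all add: fixed_point_phi Phi_append)
  then show "u = Phi p (Phi w u)" by simp
  show "fixed_point (phi (w @ p)) (Phi w u)"
    using u sset_Phi_subset[OF u(1)] by (simp add: fixed_point_phi Phi_append)
qed

lemma phi_rotate_funpow:
  "(phi (w @ p) ^^ Suc k) xs = phi w ((phi (p @ w) ^^ k) (phi p xs))"
proof (induction k)
  case 0
  show ?case by (simp add: phi_append)
next
  case (Suc k)
  have "(phi (w @ p) ^^ Suc (Suc k)) xs = phi w (phi p ((phi (w @ p) ^^ Suc k) xs))"
    unfolding funpow.simps(2)[of "Suc k"] comp_apply by (rule phi_append)
  also have "\<dots> = phi w (phi (p @ w) ((phi (p @ w) ^^ k) (phi p xs)))"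
    unfolding Suc phi_append[of p w "(phi (p @ w) ^^ k) (phi p xs)"] ..
  finally show ?case by simp
qed

lemma primitive_rotate:
  assumes "primitive (phi (p @ w))"
  shows "primitive (phi (w @ p))"
proof -
  obtain k where k: "\<And>i. i \<in> {0, 1} \<Longrightarrow> {0, 1} \<subseteq> set ((phi (p @ w) ^^ k) [i])"
    using assms unfolding primitive_def by blast
  have "{0, 1} \<subseteq> set ((phi (w @ p) ^^ Suc k) [i])" if i: "i \<in> {0, 1}" for i
  proof -
    obtain j xs where j: "phi p [i] = j # xs"
      using phi_nonempty[of "[i]" p] by (cases "phi p [i]") auto
    have "set (phi p [i]) \<subseteq> {0, 1}" using i by (intro set_phi) auto
    then have "{0, 1} \<subseteq> set ((phi (p @ w) ^^ k) [j])" using k j by auto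
    moreover have "(phi (p @ w) ^^ k) (phi p [i]) = (phi (p @ w) ^^ k) [j] @ (phi (p @ w) ^^ k) xs"
      unfolding j phi_funpow using phi_hom[of _ "[j]" xs] by simp
    ultimately show ?thesis unfolding phi_rotate_funpow by (intro set_phi_full) auto
  qed
  then show ?thesis unfolding primitive_def by blast
qed

lemma fixed_point_power:
  assumes "fixed_point (phi w) x"
  shows "Phi (concat (replicate k w)) x = x"
proof (induction k)
  case 0
  show ?case using subst_singleton[of id x] by (simp add: Phi_def stream.map_id)
next
  case (Suc k)
  then show ?case using assms by (simp add: Phi_append fixed_point_phi)
qed

lemma primitive_power:
  assumes "primitive (phi w)"
  obtains v where "\<And>i. i \<in> {0, 1} \<Longrightarrow> {0, 1} \<subseteq> set (phi v [i])"
    and "\<And>x. fixed_point (phi w) x \<Longrightarrow> Phi v x = x"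
  using assms fixed_point_power unfolding primitive_def phi_funpow by blast

lemma sset_fixed_point:
  assumes "primitive (phi w)" "fixed_point (phi w) x"
  shows "sset x = {0, 1}"
proof
  show sub: "sset x \<subseteq> {0, 1}" using assms(2) by (simp add: fixed_point_phi)
  obtain v where v: "\<And>i. i \<in> {0, 1} \<Longrightarrow> {0, 1} \<subseteq> set (phi v [i])" "Phi v x = x"
    using primitive_power[OF assms(1)] assms(2) by metis
  have "shd x \<in> {0, 1}" using sub by (meson shd_sset subsetD)
  then have "{0, 1} \<subseteq> set (phi v [shd x])" by (rule v(1))
  also have "\<dots> \<subseteq> sset (Phi v x)" unfolding sset_Phi using shd_sset by blast
  finally show "{0, 1} \<subseteq> sset x" unfolding v(2) .
qed

lemma length_concat_map_ge:
  "(\<And>i. i \<in> set xs \<Longrightarrow> m \<le> length (f i)) \<Longrightarrow> m * length xs \<le> length (concat (map f xs))"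
proof (induction xs)
  case (Cons a xs)
  then have "m \<le> length (f a)" "m * length xs \<le> length (concat (map f xs))" by auto
  then show ?case by simp
qed simp

text \<open>Both fixed points begin with the common first letter of the images, and a power of the morphism
  at least doubles the length of the common prefix.\<close>

lemma fixed_point_unique:
  assumes w: "primitive (phi w)" "\<not> set w \<subseteq> {LA, Alpha}"
    and x: "fixed_point (phi w) x" and y: "fixed_point (phi w) y"
  shows "x = y"
proof -
  obtain v where v: "\<And>i. i \<in> {0, 1} \<Longrightarrow> {0, 1} \<subseteq> set (phi v [i])"
    "Phi v x = x" "Phi v y = y"
    using primitive_power[OF w(1)] x y by metis
  have two: "2 \<le> length (phi v [i])" if "i \<in> {0, 1}" for i
  proof -
    have "card {0, 1 :: nat} \<le> card (set (phi v [i]))" using v(1)[OF that] by (intro card_mono) auto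
    then show ?thesis using card_length[of "phi v [i]"] by simp
  qed
  have shd: "shd z = hd (phi w [0])" if "fixed_point (phi w) z" for z
  proof -
    have z: "sset z \<subseteq> {0, 1}" "Phi w z = z" using that by (simp_all add: fixed_point_phi)
    have "shd z \<in> {0, 1}" using z(1) by (meson shd_sset subsetD)
    moreover have "shd z = hd (phi w [shd z])"
      using arg_cong[OF z(2), of shd] unfolding Phi_def by (simp add: shd_subst phi_nonempty)
    ultimately show ?thesis using hd_phi_collapsing[OF w(2)] by auto
  qed
  have pre: "stake (Suc n) z = take (Suc n) (phi v (stake n z))"
    if "n \<ge> 1" "fixed_point (phi w) z" "Phi v z = z" for n z
  proof -
    have "set (stake n z) \<subseteq> sset z" by (metis Un_upper1 sset_shift stake_sdrop)
    also have "\<dots> \<subseteq> {0, 1}" using that(2) by (simp add: fixed_point_phi)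
    finally have "2 * length (stake n z) \<le> length (concat (map (\<lambda>i. phi v [i]) (stake n z)))"
      by (intro length_concat_map_ge two) blast
    then have "Suc n \<le> length (phi v (stake n z))"
      using that(1) by (simp flip: phi_letters)
    moreover have "z = phi v (stake n z) @- Phi v (sdrop n z)"
      using that(3) by (metis Phi_shift stake_sdrop)
    ultimately show ?thesis by (metis append_Nil2 diff_is_0_eq stake.simps(1) stake_shift)
  qed
  show ?thesis
  proof (rule stream_eqI_stake)
    fix n show "stake n x = stake n y"
    proof (induction n)
      case (Suc n)
      show ?case
      proof (cases "n = 0")
        case True
        then show ?thesis using shd x y by simp
      next
        case False
        then have "n \<ge> 1" by simp
        show ?thesis
          unfolding pre[OF \<open>n \<ge> 1\<close> x v(2)] pre[OF \<open>n \<ge> 1\<close> y v(3)] Suc ..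
      qed
    qed simp
  qed
qed

definition derivable :: "(nat list \<Rightarrow> nat list) \<Rightarrow> bool" where
  "derivable \<psi> \<longleftrightarrow> \<psi> \<in> special_morphisms \<and> primitive \<psi> \<and>
     \<not> set (normal_name \<psi>) \<subseteq> {LA, Alpha}"

lemma derivable_phi:
  "derivable (phi w) \<longleftrightarrow> primitive (phi w) \<and> \<not> set w \<subseteq> {LA, Alpha}"
proof -
  have sp: "phi w \<in> special_morphisms" by (simp add: special_morphisms_eq)
  show ?thesis
    using sp phi_normal_name[OF sp] unfolding derivable_def collapsing_iff by simp
qed

lemma derivable_obtain_name:
  assumes "derivable \<psi>"
  obtains w where "\<psi> = phi w" "primitive (phi w)" "\<not> set w \<subseteq> {LA, Alpha}"
  using assms phi_normal_name unfolding derivable_def by metis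

lemma Delta_desubst:
  assumes "derivable \<psi>" and "fixed_point \<psi> u"
  obtains s t k y where "derivable (Delta \<psi>)" "fixed_point (Delta \<psi>) y"
    "s \<noteq> t" "{s, t} = {0, 1}" "u = block s t k y"
proof -
  let ?w = "normal_name \<psi>"
  have w: "phi ?w = \<psi>" "primitive \<psi>" "\<not> set ?w \<subseteq> {LA, Alpha}"
    using assms(1) phi_normal_name by (auto simp: derivable_def)
  have rotate: "derivable (Delta \<psi>) \<and> fixed_point (Delta \<psi>) (Phi w' u) \<and> u = Phi p (Phi w' u)"
    if "?w = p @ w'" "Delta_name ?w = normalize (w' @ p)" "\<not> set p \<subseteq> {LA, Alpha}" for p w'
  proof -
    have "\<psi> = phi (p @ w')" "Delta \<psi> = phi (w' @ p)"
      using that w(1) by (simp_all add: Delta_def phi_normalize)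
    then show ?thesis
      using assms(2) w(2) that(3) fixed_point_rotate[of p w' u] primitive_rotate[of p w']
      by (auto simp: derivable_phi)
  qed
  have "\<not> set (normalize (SOME w. phi w = \<psi>)) \<subseteq> {LA, Alpha}"
    using w(3) by (simp add: normal_name_def)
  then show thesis
  proof (cases rule: normalize_head)
    case (1 k w')
    then have "?w = (replicate k LA @ [Beta]) @ w'" by (simp add: normal_name_def)
    from rotate[OF this] show thesis
      using that[of "Phi w' u" 1 0 k] Delta_name_Beta[of k w'] \<open>?w = _\<close>
      by (auto simp: Phi_block_Beta)
  next
    case (2 k w')
    then have "?w = (replicate k Alpha @ [LB]) @ w'" by (simp add: normal_name_def)
    from rotate[OF this] show thesis
      using that[of "Phi w' u" 0 1 k] Delta_name_LB[of k w'] \<open>?w = _\<close>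
      by (auto simp: Phi_block_LB)
  qed
qed

lemma derivated_imp_Delta_fixed_point:
  assumes "derivable \<psi>" "fixed_point \<psi> u" "is_prefix v u"
    and "\<exists>d. derivated_word u v d \<and> eq_up_to_perm x d"
  shows "\<exists>j y. (v \<noteq> [] \<longrightarrow> j \<ge> 1) \<and> fixed_point ((Delta ^^ j) \<psi>) y \<and> eq_up_to_perm x y"
  using assms
proof (induction "length v" arbitrary: v u \<psi> rule: less_induct)
  case less
  show ?case
  proof (cases "v = []")
    case True
    have "sset u = {0, 1}" using less.prems(1,2) derivable_obtain_name sset_fixed_point by metis
    then have "eq_up_to_perm x u"
      using less.prems(4) True derivated_word_Nil_eq_up_to_perm by blast
    then show ?thesis using less.prems(2) True by (intro exI[of _ 0] exI[of _ u]) simp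
  next
    case False
    obtain s t k y where y: "derivable (Delta \<psi>)" "fixed_point (Delta \<psi>) y"
      and b: "s \<noteq> t" "{s, t} = {0, 1}" "u = block s t k y"
      using Delta_desubst[OF less.prems(1,2)] by metis
    have "sset y \<subseteq> {s, t}" using y(2) b(2) by (simp add: fixed_point_def)
    then obtain v' where v': "is_prefix v' y" "length v' < length v"
      "\<forall>d. derivated_word u v d \<longleftrightarrow> derivated_word y v' d"
      using desubst_block[OF b(1) _ False] less.prems(3) unfolding b(3) by blast
    then obtain j z where "fixed_point ((Delta ^^ j) (Delta \<psi>)) z" "eq_up_to_perm x z"
      using less.hyps[OF v'(2) y v'(1)] less.prems(4) by metis
    then show ?thesis by (intro exI[of _ "Suc j"] exI[of _ z]) (simp add: funpow_swap1)
  qed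
qed

lemma Delta_fixed_point_imp_derivated:
  assumes "derivable \<psi>" "fixed_point \<psi> u" "fixed_point ((Delta ^^ j) \<psi>) y" "eq_up_to_perm x y"
  shows "\<exists>v d. (j \<ge> 1 \<longrightarrow> v \<noteq> []) \<and> is_prefix v u \<and> derivated_word u v d \<and> eq_up_to_perm x d"
  using assms
proof (induction j arbitrary: u \<psi>)
  case 0
  obtain w where w: "\<psi> = phi w" "primitive (phi w)" "\<not> set w \<subseteq> {LA, Alpha}"
    using derivable_obtain_name[OF "0.prems"(1)] .
  have "y = u" using 0 fixed_point_unique[OF w(2,3)] w(1) by simp
  moreover have "sset u = {0, 1}" using 0 w sset_fixed_point by simp
  ultimately have "\<exists>d. derivated_word u [] d \<and> eq_up_to_perm x d"
    using derivated_word_Nil_eq_up_to_perm "0.prems"(4) by blast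
  then show ?case using is_prefix_Nil by (metis not_one_le_zero)
next
  case (Suc j)
  obtain s t k z where z: "derivable (Delta \<psi>)" "fixed_point (Delta \<psi>) z"
    and b: "s \<noteq> t" "{s, t} = {0, 1}" "u = block s t k z"
    using Delta_desubst[OF Suc.prems(1,2)] by metis
  have "sset z \<subseteq> {s, t}" using z(2) b(2) by (simp add: fixed_point_def)
  moreover obtain v' d where v': "is_prefix v' z" "derivated_word z v' d" "eq_up_to_perm x d"
    using Suc.IH[OF z] Suc.prems(3,4) by (auto simp: funpow_swap1)
  ultimately obtain v where "v \<noteq> []" "is_prefix v u" "derivated_word u v d"
    using subst_block[OF b(1)] unfolding b(3) by blast
  then show ?case using v'(3) by blast
qed

theorem mainTheorem10:
  fixes \<psi> :: "nat list \<Rightarrow> nat list" and u x :: "nat stream"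
  assumes "\<psi> \<in> special_morphisms"
    and "primitive \<psi>"
    and "\<not> set (normal_name \<psi>) \<subseteq> {LA, Alpha}"
    and "fixed_point \<psi> u"
  shows "(\<exists>v d. v \<noteq> [] \<and> is_prefix v u \<and> derivated_word u v d \<and> eq_up_to_perm x d) \<longleftrightarrow>
         (\<exists>j\<ge>1. \<exists>y. fixed_point ((Delta ^^ j) \<psi>) y \<and> eq_up_to_perm x y)"
proof -
  have "derivable \<psi>" using assms(1-3) by (simp add: derivable_def)
  then show ?thesis
    using derivated_imp_Delta_fixed_point[OF _ assms(4)]
      Delta_fixed_point_imp_derivated[OF _ assms(4)] by blast
qed

end
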